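(* Let $\mathcal{R}=\{W_w,V_{w,v},\Lambda_w,\alpha_{w,v}\}_{w\in\Omega,v\in\Omega_w}$ be a continuous relay fusion frame for $H$ with frame operator $S_{\mathcal{R}}$. Put $\mathring{W}_w=S_{\mathcal{R}}^{-1}W_w$ and $\mathring{\Lambda}_w=\Lambda_w\pi_{W_w}S_{\mathcal{R}}^{-1}$. Then $\mathring{\mathcal{R}}=\{\mathring{W}_w,V_{w,v},\mathring{\Lambda}_w,\alpha_{w,v}\}_{w\in\Omega,v\in\Omega_w}$ is a continuous relay fusion frame for $H$.
   Context: Setting. $H$ is a separable Hilbert space and $(\Omega,\mu)$ is a positive measure space; for each $w\in\Omega$, $\Omega_w$ is a positive measure space whose measure is also denoted $\mu$. For each $w\in\Omega$, $K_w$ is a separable Hilbert space, $W_w\subseteq H$ is a closed subspace, $\Lambda_w\in B(H,K_w)$, and $\{V_{w,v}\}_{v\in\Omega_w}$ is a family of closed subspaces of $K_w$; $\alpha_{w,v}>0$ are weights. $\pi_W$ and $P_V$ denote orthogonal projections onto closed subspaces $W$ of $H$ and $V$ of $K_w$. Families are understood to be measurable so that the integrals written make sense; vector-valued integrals are understood weakly. Definition. $\mathcal{R}=\{W_w,V_{w,v},\Lambda_w,\alpha_{w,v}\}_{w\in\Omega,v\in\Omega_w}$ is a continuous relay fusion frame for $H$ with bounds $A,B$ if: (1) for each $f\in H$, $\{\Lambda_wf\}_{w\in\Omega}$ is strongly measurable; (2) for each $f\in H$, $\{\pi_{W_w}f\}_{w\in\Omega}$ is strongly measurable; (3) for each $f\in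 K_w$, $\{P_{V_{w,v}}f\}_{w\in\Omega,v\in\Omega_w}$ is strongly measurable; (4) there are constants $0<A\le B<\infty$ such that $$A\|f\|^2\le\int_\Omega\int_{\Omega_w}\alpha_{w,v}^2\|P_{V_{w,v}}\Lambda_w\pi_{W_w}f\|^2\,d\mu(v)\,d\mu(w)\le B\|f\|^2\quad\forall f\in H.$$ Its frame operator $S_{\mathcal{R}}f=\int_\Omega\int_{\Omega_w}\alpha_{w,v}^2\pi_{W_w}\Lambda_w^*P_{V_{w,v}}\Lambda_w\pi_{W_w}f\,d\mu(v)\,d\mu(w)$ is a bounded, positive, invertible operator on $H$. *)

theory Defs
  imports "HOL-Analysis.Analysis"
begin

text \<open>
  Real and complex Hilbert spaces are treated together. The types carry the real inner product
  \<open>x \<bullet> y\<close>, that is, the real part of the scalar-valued one, and \<open>sc\<close> is the multiplication by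
  scalars from \<open>'f\<close>. Up to isomorphism, \<open>\<real>\<close> and \<open>\<complex>\<close> are the only instances of
  \<^class>\<open>real_normed_field\<close> (Mazur), and the norm determines the scalar-valued inner product by
  polarization. For subspaces and linear maps over \<open>'f\<close>, orthogonal complements and adjoints
  are the same for both inner products, and so is an identity \<open>\<langle>h, g\<rangle> = \<integral>\<langle>F, g\<rangle>\<close>
  required for all \<open>g\<close> (replace \<open>g\<close> by \<open>\<i>g\<close>).
\<close>

definition hilbert_scalars :: "('f::real_normed_field \<Rightarrow> 'h \<Rightarrow> 'h::{real_inner,complete_space}) \<Rightarrow> bool"
  where "hilbert_scalars sc \<longleftrightarrow>
    vector_space sc \<and>
    (\<forall>r x. sc (of_real r) x = r *\<^sub>R x) \<and>
    (\<forall>c x. norm (sc c x) = norm c * norm x)"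

lemma hilbert_scalars_real:
  "hilbert_scalars (scaleR :: real \<Rightarrow> 'h \<Rightarrow> 'h::{real_inner,complete_space})"
  by (auto simp: hilbert_scalars_def real_vector.vector_space_axioms)

lemma hilbert_scalars_complex:
  "hilbert_scalars ((*) :: complex \<Rightarrow> complex \<Rightarrow> complex)"
  by (auto simp: hilbert_scalars_def vector_space_def algebra_simps scaleR_conv_of_real norm_mult)

definition closed_subspace :: "('f::real_normed_field \<Rightarrow> 'h \<Rightarrow> 'h::real_inner) \<Rightarrow> 'h set \<Rightarrow> bool"
  where "closed_subspace sc U \<longleftrightarrow> closed U \<and> module.subspace sc U"

definition orth_proj :: "'h::real_inner set \<Rightarrow> 'h \<Rightarrow> 'h"
  where "orth_proj U x = (THE y. y \<in> U \<and> (\<forall>u\<in>U. orthogonal (x - y) u))"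

definition strongly_measurable :: "'x measure \<Rightarrow> ('x \<Rightarrow> 'h::metric_space) \<Rightarrow> bool"
  where "strongly_measurable M f \<longleftrightarrow>
    (\<exists>s. (\<forall>n. simple_function M (s n)) \<and> (\<forall>x\<in>space M. (\<lambda>n. s n x) \<longlonglongrightarrow> f x))"

text \<open>
  In what follows \<open>M\<close> is the measure space \<open>\<Omega>\<close> and \<open>N w\<close> is \<open>\<Omega>\<^sub>w\<close>. The spaces \<open>K w\<close> are closed
  subspaces of one Hilbert space type \<open>'k\<close>, which need not be separable, so that measurability of
  \<open>w \<mapsto> \<Lambda> w f\<close> has a meaning. Accordingly \<open>\<Lambda> w\<close> is a map into \<open>'k\<close> with range in \<open>K w\<close>; on
  \<open>K w\<close>, \<open>adjoint (\<Lambda> w)\<close> is the adjoint of \<open>\<Lambda> w\<close> as an operator into \<open>K w\<close>.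
\<close>

definition relay_energy ::
  "('w \<Rightarrow> 'h::real_inner set) \<Rightarrow> ('w \<Rightarrow> 'v \<Rightarrow> 'k::real_inner set) \<Rightarrow> ('w \<Rightarrow> 'h \<Rightarrow> 'k) \<Rightarrow>
   ('w \<Rightarrow> 'v \<Rightarrow> real) \<Rightarrow> 'h \<Rightarrow> 'w \<Rightarrow> 'v \<Rightarrow> real"
  where "relay_energy W V \<Lambda> \<alpha> f w v =
    (\<alpha> w v)\<^sup>2 * (norm (orth_proj (V w v) (\<Lambda> w (orth_proj (W w) f))))\<^sup>2"

definition relay_integrand ::
  "('w \<Rightarrow> 'h::real_inner set) \<Rightarrow> ('w \<Rightarrow> 'v \<Rightarrow> 'k::real_inner set) \<Rightarrow> ('w \<Rightarrow> 'h \<Rightarrow> 'k) \<Rightarrow>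
   ('w \<Rightarrow> 'v \<Rightarrow> real) \<Rightarrow> 'h \<Rightarrow> 'w \<Rightarrow> 'v \<Rightarrow> 'h"
  where "relay_integrand W V \<Lambda> \<alpha> f w v =
    (\<alpha> w v)\<^sup>2 *\<^sub>R orth_proj (W w) (adjoint (\<Lambda> w) (orth_proj (V w v) (\<Lambda> w (orth_proj (W w) f))))"

text \<open>
  The measurability of the weights and of the two families of inner integrals below is the
  standing convention that the iterated integrals in the frame inequality and in the
  (weakly defined) frame operator make sense.
\<close>

definition relay_fusion_frame_bounds ::
  "('f::real_normed_field \<Rightarrow> 'h \<Rightarrow> 'h::{real_inner,polish_space}) \<Rightarrow>
   ('f \<Rightarrow> 'k \<Rightarrow> 'k::{real_inner,complete_space}) \<Rightarrow>
   'w measure \<Rightarrow> ('w \<Rightarrow> 'v measure) \<Rightarrow> ('w \<Rightarrow> 'k set) \<Rightarrow>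
   ('w \<Rightarrow> 'h set) \<Rightarrow> ('w \<Rightarrow> 'v \<Rightarrow> 'k set) \<Rightarrow> ('w \<Rightarrow> 'h \<Rightarrow> 'k) \<Rightarrow> ('w \<Rightarrow> 'v \<Rightarrow> real) \<Rightarrow>
   real \<Rightarrow> real \<Rightarrow> bool"
  where "relay_fusion_frame_bounds scH scK M N K W V \<Lambda> \<alpha> A B \<longleftrightarrow>
    (\<forall>w\<in>space M. closed_subspace scH (W w)) \<and>
    (\<forall>w\<in>space M. Vector_Spaces.linear scH scK (\<Lambda> w) \<and> bounded_linear (\<Lambda> w) \<and> range (\<Lambda> w) \<subseteq> K w) \<and>
    (\<forall>w\<in>space M. \<forall>v\<in>space (N w). closed_subspace scK (V w v) \<and> V w v \<subseteq> K w \<and> 0 < \<alpha> w v) \<and>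
    (\<forall>w\<in>space M. \<alpha> w \<in> borel_measurable (N w)) \<and>
    (\<forall>f. (\<lambda>w. \<integral>\<^sup>+v. ennreal (relay_energy W V \<Lambda> \<alpha> f w v) \<partial>N w) \<in> borel_measurable M) \<and>
    (\<forall>f g. (\<lambda>w. LINT v|N w. relay_integrand W V \<Lambda> \<alpha> f w v \<bullet> g) \<in> borel_measurable M) \<and>
    (\<forall>f. strongly_measurable M (\<lambda>w. \<Lambda> w f)) \<and>
    (\<forall>f. strongly_measurable M (\<lambda>w. orth_proj (W w) f)) \<and>
    (\<forall>w\<in>space M. \<forall>f\<in>K w. strongly_measurable (N w) (\<lambda>v. orth_proj (V w v) f)) \<and>
    0 < A \<and> A \<le> B \<and>
    (\<forall>f. ennreal (A * (norm f)\<^sup>2)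
           \<le> (\<integral>\<^sup>+w. (\<integral>\<^sup>+v. ennreal (relay_energy W V \<Lambda> \<alpha> f w v) \<partial>N w) \<partial>M) \<and>
         (\<integral>\<^sup>+w. (\<integral>\<^sup>+v. ennreal (relay_energy W V \<Lambda> \<alpha> f w v) \<partial>N w) \<partial>M)
           \<le> ennreal (B * (norm f)\<^sup>2))"

definition continuous_relay_fusion_frame ::
  "('f::real_normed_field \<Rightarrow> 'h \<Rightarrow> 'h::{real_inner,polish_space}) \<Rightarrow>
   ('f \<Rightarrow> 'k \<Rightarrow> 'k::{real_inner,complete_space}) \<Rightarrow>
   'w measure \<Rightarrow> ('w \<Rightarrow> 'v measure) \<Rightarrow> ('w \<Rightarrow> 'k set) \<Rightarrow>
   ('w \<Rightarrow> 'h set) \<Rightarrow> ('w \<Rightarrow> 'v \<Rightarrow> 'k set) \<Rightarrow> ('w \<Rightarrow> 'h \<Rightarrow> 'k) \<Rightarrow> ('w \<Rightarrow> 'v \<Rightarrow> real) \<Rightarrow> bool"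
  where "continuous_relay_fusion_frame scH scK M N K W V \<Lambda> \<alpha> \<longleftrightarrow>
    (\<exists>A B. relay_fusion_frame_bounds scH scK M N K W V \<Lambda> \<alpha> A B)"

definition relay_frame_operator ::
  "'w measure \<Rightarrow> ('w \<Rightarrow> 'v measure) \<Rightarrow>
   ('w \<Rightarrow> 'h::real_inner set) \<Rightarrow> ('w \<Rightarrow> 'v \<Rightarrow> 'k::real_inner set) \<Rightarrow> ('w \<Rightarrow> 'h \<Rightarrow> 'k) \<Rightarrow>
   ('w \<Rightarrow> 'v \<Rightarrow> real) \<Rightarrow> 'h \<Rightarrow> 'h"
  where "relay_frame_operator M N W V \<Lambda> \<alpha> f =
    (THE h. \<forall>g. h \<bullet> g = (LINT w|M. (LINT v|N w. relay_integrand W V \<Lambda> \<alpha> f w v \<bullet> g)))"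

end

theory Submission
  imports Defs
begin

text \<open>
  By Riesz, the frame operator \<open>S\<close> represents the symmetric form obtained by polarizing the frame
  energy; as \<open>A \<parallel>f\<parallel>\<^sup>2 \<le> \<langle>S f, f\<rangle>\<close> and \<open>\<parallel>S f\<parallel> \<le> B \<parallel>f\<parallel>\<close>, it is
  invertible. Its inverse \<open>T\<close> is self-adjoint, so \<open>\<pi>\<^sub>W T = \<pi>\<^sub>W T \<pi>\<close> with \<open>\<pi>\<close> the
  projection onto \<open>T W\<close>. Hence the energy of \<open>f\<close> in the new family is the energy of \<open>T f\<close> in the
  old one, which gives the bounds \<open>A / B\<^sup>2\<close> and \<open>B / A\<^sup>2\<close>. Measurability of
  \<open>w \<mapsto> \<pi> f\<close> comes from writing the distance of \<open>f\<close> to \<open>T W\<close> as an infimum over a countable dense set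
  of vectors \<open>d\<close> of \<open>\<parallel>f - T \<pi>\<^sub>W d\<parallel>\<close>, and polarizing.
\<close>

section \<open>Orthogonal projections and the Riesz representation\<close>

text \<open>The parallelogram law for \<open>x - a\<close> and \<open>x - b\<close> bounds the gap
  between \<open>a\<close> and \<open>b\<close> through their midpoint, which lies in
  \<open>U\<close> and hence has squared distance at least \<open>d\<close> from \<open>x\<close>.
  This makes minimizing sequences Cauchy.\<close>

lemma norm_cauchy_of_minimizing:
  fixes x :: "'h::real_inner"
  assumes "subspace U" "a \<in> U" "b \<in> U"
    and low: "\<And>u. u \<in> U \<Longrightarrow> d \<le> (norm (x - u))\<^sup>2"
    and "(norm (x - a))\<^sup>2 \<le> d + r" "(norm (x - b))\<^sup>2 \<le> d + s"
  shows "(norm (a - b))\<^sup>2 \<le> 2 * r + 2 * s"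
proof -
  have "(1/2) *\<^sub>R (a + b) \<in> U"
    using assms by (intro subspace_scale subspace_add)
  then have "d \<le> (norm (x - (1/2) *\<^sub>R (a + b)))\<^sup>2" by (rule low)
  moreover have "(norm (a - b))\<^sup>2 =
      2 * (norm (x - a))\<^sup>2 + 2 * (norm (x - b))\<^sup>2 - 4 * (norm (x - (1/2) *\<^sub>R (a + b)))\<^sup>2"
    unfolding power2_norm_eq_inner by (simp add: inner_simps inner_commute algebra_simps)
  ultimately show ?thesis using assms by linarith
qed

text \<open>A sequence in \<open>U\<close> minimizing the squared distance to \<open>x\<close> is
  Cauchy, so it converges to a nearest point \<open>z\<close> of the closed set \<open>U\<close>.
  Moving \<open>z\<close> along \<open>u\<close> cannot reduce the distance, which forces
  orthogonality.\<close>

lemma orth_proj_exists: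
  fixes x :: "'h::{real_inner,complete_space}"
  assumes "closed U" "subspace U"
  shows "\<exists>y\<in>U. \<forall>u\<in>U. orthogonal (x - y) u"
proof -
  define d where "d = (INF u\<in>U. (norm (x - u))\<^sup>2)"
  have ne: "U \<noteq> {}" using assms(2) subspace_0 by auto
  have bdd: "bdd_below ((\<lambda>u. (norm (x - u))\<^sup>2) ` U)"
    by (rule bdd_belowI[of _ 0]) auto
  have low: "d \<le> (norm (x - u))\<^sup>2" if "u \<in> U" for u
    unfolding d_def using bdd that by (rule cINF_lower)
  have "\<exists>u\<in>U. (norm (x - u))\<^sup>2 < d + 1 / real (Suc n)" for n
    using cINF_less_iff[OF ne bdd, of "d + 1 / real (Suc n)"] unfolding d_def[symmetric] by simp
  then obtain y where yU: "\<And>n. y n \<in> U"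
    and y: "\<And>n. (norm (x - y n))\<^sup>2 < d + 1 / real (Suc n)" by metis
  have cauchy: "(norm (y m - y n))\<^sup>2 \<le> 2 * (1 / real (Suc m)) + 2 * (1 / real (Suc n))" for m n
    using assms(2) yU low y[THEN less_imp_le] by (intro norm_cauchy_of_minimizing) auto
  have "Cauchy y"
  proof (rule metric_CauchyI)
    fix e :: real assume "e > 0"
    \<comment> \<open>For \<open>m\<close> and \<open>n\<close> at least \<open>k\<close>, the two
      error terms in \<open>cauchy\<close> add up to at most
      \<open>4 / real (Suc k)\<close>.\<close>
    then obtain k where k: "4 / e\<^sup>2 < real (Suc k)"
      by (meson lessI less_trans of_nat_less_iff reals_Archimedean2)
    show "\<exists>k. \<forall>m\<ge>k. \<forall>n\<ge>k. dist (y m) (y n) < e"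
    proof (intro exI allI impI)
      fix m n assume "k \<le> m" "k \<le> n"
      then have "1 / real (Suc m) \<le> 1 / real (Suc k)" "1 / real (Suc n) \<le> 1 / real (Suc k)"
        by (auto intro!: divide_left_mono)
      then have "(norm (y m - y n))\<^sup>2 \<le> 4 / real (Suc k)"
        using cauchy[of m n] by linarith
      also have "\<dots> < e\<^sup>2"
        using k \<open>e > 0\<close> by (simp add: field_simps)
      finally show "dist (y m) (y n) < e"
        using \<open>e > 0\<close> unfolding dist_norm by (simp add: power2_less_imp_less)
    qed
  qed
  then obtain z where z: "y \<longlonglongrightarrow> z"
    using Cauchy_convergent convergent_def by blast
  have zU: "z \<in> U" using assms(1) yU z by (rule closed_sequentially)
  have "(\<lambda>n. (norm (x - y n))\<^sup>2) \<longlonglongrightarrow> (norm (x - z))\<^sup>2"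
    by (intro tendsto_intros z)
  moreover have "(\<lambda>n. d + 1 / real (Suc n)) \<longlonglongrightarrow> d + 0"
    by (intro tendsto_add tendsto_const) (use LIMSEQ_inverse_real_of_nat in \<open>simp add: inverse_eq_divide\<close>)
  ultimately have "(norm (x - z))\<^sup>2 \<le> d + 0"
    by (rule LIMSEQ_le) (use y less_imp_le in blast)
  then have min: "(norm (x - z))\<^sup>2 \<le> (norm (x - u))\<^sup>2" if "u \<in> U" for u
    using low[OF that] by linarith
  have "(x - z) \<bullet> u = 0" if "u \<in> U" for u
  proof (cases "u = 0")
    case False
    \<comment> \<open>The minimizer of the quadratic
      \<open>(norm (x - (z + t *\<^sub>R u)))\<^sup>2\<close> in \<open>t\<close>; the resulting
      change must be nonnegative although it is minus a square over
      \<open>u \<bullet> u\<close>.\<close>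
    define t where "t = ((x - z) \<bullet> u) / (u \<bullet> u)"
    have "z + t *\<^sub>R u \<in> U" using assms(2) zU that by (intro subspace_add subspace_scale)
    from min[OF this] have "0 \<le> t * t * (u \<bullet> u) - 2 * t * ((x - z) \<bullet> u)"
      unfolding power2_norm_eq_inner by (simp add: inner_simps inner_commute algebra_simps)
    also have "\<dots> = - ((x - z) \<bullet> u)\<^sup>2 / (u \<bullet> u)"
      using False by (simp add: t_def field_simps power2_eq_square)
    finally have "((x - z) \<bullet> u)\<^sup>2 / (u \<bullet> u) \<le> 0" by simp
    moreover have "u \<bullet> u > 0" using False by simp
    ultimately have "((x - z) \<bullet> u)\<^sup>2 \<le> 0" by (simp add: divide_le_0_iff)
    then show ?thesis by simp
  qed simp
  with zU show ?thesis by (auto simp: orthogonal_def)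
qed

text \<open>The difference of two candidates lies in \<open>U\<close> and is orthogonal to itself.
  This turns the definite description into a test by which projections are identified below.\<close>

lemma orth_proj_unique:
  fixes x :: "'h::real_inner"
  assumes "subspace U" "y \<in> U" "\<And>u. u \<in> U \<Longrightarrow> (x - y) \<bullet> u = 0"
  shows "orth_proj U x = y"
  unfolding orth_proj_def
proof (rule the_equality)
  show "y \<in> U \<and> (\<forall>u\<in>U. orthogonal (x - y) u)" using assms by (auto simp: orthogonal_def)
  fix z assume z: "z \<in> U \<and> (\<forall>u\<in>U. orthogonal (x - z) u)"
  have "z - y \<in> U" using z assms by (intro subspace_diff) auto
  then have "(x - y) \<bullet> (z - y) = 0" "(x - z) \<bullet> (z - y) = 0"
    using z assms by (auto simp: orthogonal_def)
  then have "(z - y) \<bullet> (z - y) = 0" by (simp add: inner_diff_left)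
  then show "z = y" by simp
qed

lemma
  fixes x :: "'h::{real_inner,complete_space}"
  assumes U: "closed U" "subspace U"
  shows orth_proj_in: "orth_proj U x \<in> U"
    and orth_proj_residual: "u \<in> U \<Longrightarrow> (x - orth_proj U x) \<bullet> u = 0"
proof -
  obtain y where y: "y \<in> U" "\<And>u. u \<in> U \<Longrightarrow> (x - y) \<bullet> u = 0"
    using orth_proj_exists[OF U, of x] by (auto simp: orthogonal_def)
  then have "orth_proj U x = y" by (intro orth_proj_unique U)
  with y show "orth_proj U x \<in> U" "u \<in> U \<Longrightarrow> (x - orth_proj U x) \<bullet> u = 0" by auto
qed

context
  fixes U :: "'h::{real_inner,complete_space} set"
  assumes U: "closed U" "subspace U"
begin

lemma orth_proj_inner_left: "u \<in> U \<Longrightarrow> orth_proj U x \<bullet> u = x \<bullet> u"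
  using orth_proj_residual[OF U, of u x] by (simp add: inner_diff_left)

lemma orth_proj_inner_right: "u \<in> U \<Longrightarrow> u \<bullet> orth_proj U x = u \<bullet> x"
  using orth_proj_inner_left[of u x] by (simp add: inner_commute)

lemma orth_proj_symmetric: "orth_proj U x \<bullet> y = x \<bullet> orth_proj U y"
  by (metis orth_proj_in[OF U] orth_proj_inner_left orth_proj_inner_right)

lemma norm_orth_proj_eq: "(norm (orth_proj U x))\<^sup>2 = orth_proj U x \<bullet> x"
  by (simp add: power2_norm_eq_inner orth_proj_in[OF U] orth_proj_inner_right)

lemma norm_orth_proj_residual:
  "(norm (x - orth_proj U x))\<^sup>2 = (norm x)\<^sup>2 - (norm (orth_proj U x))\<^sup>2"
  using norm_orth_proj_eq[of x]
  by (simp add: power2_norm_eq_inner inner_simps inner_commute)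

lemma norm_orth_proj_le: "norm (orth_proj U x) \<le> norm x"
  using norm_orth_proj_residual[of x]
  by (metis diff_ge_0_iff_ge norm_ge_zero power2_le_imp_le zero_le_power2)

lemma bounded_linear_orth_proj: "bounded_linear (orth_proj U)"
proof (rule bounded_linear_intro[where K = 1])
  note P = orth_proj_in[OF U]
  show "orth_proj U (x + y) = orth_proj U x + orth_proj U y" for x y
    by (rule orth_proj_unique[OF U(2)])
      (auto intro!: subspace_add U P simp: inner_simps orth_proj_inner_left)
  show "orth_proj U (r *\<^sub>R x) = r *\<^sub>R orth_proj U x" for r x
    by (rule orth_proj_unique[OF U(2)])
      (auto intro!: subspace_scale U P simp: inner_simps orth_proj_inner_left)
  show "norm (orth_proj U x) \<le> norm x * 1" for x
    by (simp add: norm_orth_proj_le)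
qed

lemma norm_orth_proj_residual_le: "u \<in> U \<Longrightarrow> norm (x - orth_proj U x) \<le> norm (x - u)"
proof -
  assume u: "u \<in> U"
  have "orth_proj U x - u \<in> U" by (intro subspace_diff U u orth_proj_in)
  from orth_proj_residual[OF U this, of x]
  have "(norm (x - u))\<^sup>2 = (norm (x - orth_proj U x))\<^sup>2 + (norm (orth_proj U x - u))\<^sup>2"
    unfolding power2_norm_eq_inner by (simp add: inner_simps inner_commute)
  then show ?thesis by (auto intro: power2_le_imp_le[OF _ norm_ge_zero])
qed

end

section \<open>Riesz representation, adjoints and inversion of coercive operators\<close>

lemma riesz_representation:
  fixes \<phi> :: "'h::{real_inner,complete_space} \<Rightarrow> real"
  assumes "bounded_linear \<phi>"
  shows "\<exists>h. \<forall>x. \<phi> x = h \<bullet> x"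
proof (cases "\<forall>x. \<phi> x = 0")
  case True
  then show ?thesis by (intro exI[of _ 0]) simp
next
  case False
  interpret bounded_linear \<phi> by fact
  let ?U = "\<phi> -` {0}"
  have U: "closed ?U" "subspace ?U"
    by (auto intro!: continuous_closed_vimage continuous_at simp: subspace_def zero add scale
        intro: linear_continuous_at assms)
  obtain x0 where x0: "\<phi> x0 \<noteq> 0" using False by blast
  \<comment> \<open>Removing the kernel component leaves a vector orthogonal to the kernel on which
    \<phi> is still nonzero. For every \<open>x\<close> the combination
    \<open>\<phi> z *\<^sub>R x - \<phi> x *\<^sub>R z\<close> lies in the kernel, and pairing it
    with \<open>z\<close> solves for \<open>\<phi> x\<close>.\<close>
  define z where "z = x0 - orth_proj ?U x0"
  have \<phi>z: "\<phi> z = \<phi> x0"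
    using orth_proj_in[OF U, of x0] by (simp add: z_def diff)
  have zz: "z \<bullet> z > 0" using \<phi>z x0 zero by auto
  have "\<phi> x = ((\<phi> z / (z \<bullet> z)) *\<^sub>R z) \<bullet> x" for x
  proof -
    have "\<phi> z *\<^sub>R x - \<phi> x *\<^sub>R z \<in> ?U" by (simp add: diff scale)
    then have "z \<bullet> (\<phi> z *\<^sub>R x - \<phi> x *\<^sub>R z) = 0"
      unfolding z_def by (intro orth_proj_residual U)
    then show ?thesis using zz by (simp add: inner_simps field_simps)
  qed
  then show ?thesis by blast
qed

text \<open>\<open>adjoint\<close> is a choice operator, so its defining property is available only
  once some adjoint exists; Riesz provides one, vector by vector in \<open>y\<close>.\<close>

lemma adjoint_inner:
  fixes T :: "'h::{real_inner,complete_space} \<Rightarrow> 'k::real_inner"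
  assumes "bounded_linear T"
  shows "x \<bullet> adjoint T y = T x \<bullet> y"
proof -
  have "\<exists>h. \<forall>x. T x \<bullet> y = h \<bullet> x" for y
    by (rule riesz_representation)
      (rule bounded_linear_compose[OF bounded_linear_inner_left assms])
  then have "\<exists>T'. \<forall>x y. T x \<bullet> y = x \<bullet> T' y" by (metis inner_commute)
  then have "\<forall>x y. T x \<bullet> y = x \<bullet> adjoint T y"
    unfolding adjoint_def by (rule someI_ex)
  then show ?thesis by simp
qed

text \<open>The Lax-Milgram argument: for a suitable step \<open>c\<close> the map sending
  \<open>x\<close> to \<open>x - c *\<^sub>R (S x - h)\<close> is a contraction, and its fixed point
  solves \<open>S x = h\<close>. Coercivity also makes the kernel trivial.\<close>

lemma coercive_bij:
  fixes S :: "'h::{real_inner,complete_space} \<Rightarrow> 'h"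
  assumes "bounded_linear S" "0 < A" and coercive: "\<And>x. A * (norm x)\<^sup>2 \<le> S x \<bullet> x"
  shows "bij S"
proof -
  interpret bounded_linear S by fact
  obtain B where B: "\<And>x. norm (S x) \<le> norm x * B" "B > 0" using pos_bounded by auto
  \<comment> \<open>This \<open>c\<close> minimizes
    \<open>1 - 2 * c * A + c\<^sup>2 * B\<^sup>2\<close>, with minimal value
    \<open>1 - A\<^sup>2 / B\<^sup>2\<close>. On the zero space \<open>A\<close> may exceed
    \<open>B\<close>, hence the maximum with 0 in \<open>q\<close>.\<close>
  define c where "c = A / B\<^sup>2"
  define q where "q = max 0 (1 - A\<^sup>2 / B\<^sup>2)"
  have c: "c > 0" using assms(2) B(2) by (simp add: c_def)
  have q: "0 \<le> q" "q < 1" using assms(2) B(2) by (auto simp: q_def)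
  have contr: "norm (x - c *\<^sub>R S x) \<le> sqrt q * norm x" for x
  proof -
    have "(norm (x - c *\<^sub>R S x))\<^sup>2 = (norm x)\<^sup>2 - 2 * c * (S x \<bullet> x) + c\<^sup>2 * (norm (S x))\<^sup>2"
      unfolding power2_norm_eq_inner
      by (simp add: inner_simps inner_commute algebra_simps power2_eq_square)
    also have "\<dots> \<le> (norm x)\<^sup>2 - 2 * c * (A * (norm x)\<^sup>2) + c\<^sup>2 * (norm x * B)\<^sup>2"
      using c coercive[of x] B(1)[of x]
      by (intro add_mono diff_mono mult_left_mono power_mono) auto
    also have "\<dots> = (1 - A\<^sup>2 / B\<^sup>2) * (norm x)\<^sup>2"
      using B(2) by (simp add: c_def field_simps power2_eq_square)
    also have "\<dots> \<le> q * (norm x)\<^sup>2" by (intro mult_right_mono) (auto simp: q_def)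
    also have "\<dots> = (sqrt q * norm x)\<^sup>2" using q by (simp add: power_mult_distrib)
    finally show ?thesis by (rule power2_le_imp_le) (use q in auto)
  qed
  have "\<exists>x. S x = h" for h
  proof -
    have "\<exists>!x. x - c *\<^sub>R (S x - h) = x"
    proof (rule banach_fix_type)
      show "0 \<le> sqrt q" "sqrt q < 1" using q by auto
      show "\<forall>x y. dist (x - c *\<^sub>R (S x - h)) (y - c *\<^sub>R (S y - h)) \<le> sqrt q * dist x y"
      proof (intro allI)
        fix x y
        have "x - c *\<^sub>R (S x - h) - (y - c *\<^sub>R (S y - h)) = (x - y) - c *\<^sub>R S (x - y)"
          by (simp add: diff algebra_simps)
        then show "dist (x - c *\<^sub>R (S x - h)) (y - c *\<^sub>R (S y - h)) \<le> sqrt q * dist x y"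
          unfolding dist_norm using contr[of "x - y"] by presburger
      qed
    qed
    then obtain x where "x - c *\<^sub>R (S x - h) = x" by blast
    then have "c *\<^sub>R (S x - h) = 0" by (metis diff_add_cancel add_cancel_right_right diff_eq_eq)
    then have "S x = h" using c by simp
    then show ?thesis ..
  qed
  moreover have "inj S"
  proof (rule linear_injective_0[THEN iffD2, OF linear_axioms], safe)
    fix x assume "S x = 0"
    then have "A * (norm x)\<^sup>2 \<le> 0" using coercive[of x] by simp
    then show "x = 0" using assms(2) by (simp add: mult_le_0_iff)
  qed
  ultimately show ?thesis by (metis bijI surjI)
qed

section \<open>Strong measurability\<close>

text \<open>A Pettis-type criterion with distances in place of functionals. Simple approximants
  supply a countable set whose closure contains the range; conversely, choosing a nearest point
  among the first members of a countable set builds simple approximants.\<close>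

lemma strongly_measurable_iff:
  fixes f :: "'x \<Rightarrow> 'h::metric_space"
  shows "strongly_measurable M f \<longleftrightarrow>
    (\<forall>c. (\<lambda>x. dist (f x) c) \<in> borel_measurable M) \<and> (\<exists>D. countable D \<and> f ` space M \<subseteq> closure D)"
    (is "_ \<longleftrightarrow> ?R")
proof
  assume "strongly_measurable M f"
  then obtain s where s: "\<And>n. simple_function M (s n)"
    and lim: "\<And>x. x \<in> space M \<Longrightarrow> (\<lambda>n. s n x) \<longlonglongrightarrow> f x"
    unfolding strongly_measurable_def by blast
  have "(\<lambda>x. dist (f x) c) \<in> borel_measurable M" for c
  proof (rule borel_measurable_LIMSEQ_metric)
    show "(\<lambda>x. dist (s n x) c) \<in> borel_measurable M" for n
      by (rule borel_measurable_simple_function[OF simple_function_compose1[OF s]])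
    show "x \<in> space M \<Longrightarrow> (\<lambda>n. dist (s n x) c) \<longlonglongrightarrow> dist (f x) c" for x
      by (intro tendsto_intros lim)
  qed
  moreover have "countable (\<Union>n. s n ` space M)"
    by (rule countable_UN[OF countableI_type countable_finite[OF simple_functionD(1)[OF s]]])
  moreover have "f ` space M \<subseteq> closure (\<Union>n. s n ` space M)"
  proof safe
    fix x assume x: "x \<in> space M"
    show "f x \<in> closure (\<Union>n. s n ` space M)"
      unfolding closure_sequential
      by (rule exI[of _ "\<lambda>n. s n x"], rule conjI[OF _ lim[OF x]]) (use x in blast)
  qed
  ultimately show ?R by blast
next
  assume R: ?R
  then have meas[measurable]: "\<And>c. (\<lambda>x. dist (f x) c) \<in> borel_measurable M" by blast
  from R obtain D where D: "countable D" "f ` space M \<subseteq> closure D" by blast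
  show "strongly_measurable M f"
  \<comment> \<open>The empty space is split off because enumerating \<open>D\<close> by
    \<open>from_nat_into\<close> requires \<open>D\<close> to be nonempty.\<close>
  proof (cases "space M = {}")
    case True
    then show ?thesis
      unfolding strongly_measurable_def by (intro exI[of _ "\<lambda>_ _. undefined"]) auto
  next
    case False
    then have "D \<noteq> {}" using D by auto
    define d where "d = from_nat_into D"
    have d: "range d = D" unfolding d_def using D(1) \<open>D \<noteq> {}\<close> by (simp add: range_from_nat_into)
    \<comment> \<open>\<open>P n i x\<close> says that \<open>d i\<close> is nearest to
      \<open>f x\<close> among \<open>d 0, ..., d n\<close>. Taking the least such \<open>i\<close>
      breaks ties in a measurable way, and the bound by \<open>n\<close> leaves finitely many
      values.\<close>
    define P where "P n i x \<longleftrightarrow> i \<le> n \<and> (\<forall>j\<in>{..n}. dist (f x) (d i) \<le> dist (f x) (d j))" for n i x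
    define k where "k n x = (LEAST i. P n i x)" for n x
    have "\<exists>i. P n i x" for n x
    proof -
      have "\<exists>i\<in>{..n}. \<forall>j\<in>{..n}. dist (f x) (d i) \<le> dist (f x) (d j)"
        by (intro bexI[of _ "arg_min_on (\<lambda>i. dist (f x) (d i)) {..n}"] ballI arg_min_least
            arg_min_if_finite) auto
      then show ?thesis unfolding P_def by auto
    qed
    then have Pk: "P n (k n x) x" for n x unfolding k_def by (rule LeastI_ex)
    have [measurable]: "(\<lambda>x. P n i x) \<in> measurable M (count_space UNIV)" for n i
      unfolding P_def by measurable
    have k_meas: "k n \<in> measurable M (count_space UNIV)" for n
      unfolding k_def by measurable
    have "k n ` space M \<subseteq> {..n}" for n using Pk[of n] by (auto simp: P_def)
    then have "simple_function M (k n)" for n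
      unfolding simple_function_def using measurable_sets[OF k_meas]
      by (auto intro: finite_subset)
    then have "simple_function M (\<lambda>x. d (k n x))" for n by (rule simple_function_compose1)
    moreover have "(\<lambda>n. d (k n x)) \<longlonglongrightarrow> f x" if x: "x \<in> space M" for x
    proof (rule metric_LIMSEQ_I)
      fix r :: real assume "r > 0"
      have "f x \<in> closure (range d)" using D(2) x d by auto
      then obtain m where m: "dist (d m) (f x) < r"
        using \<open>r > 0\<close> unfolding closure_approachable by blast
      have "dist (d (k n x)) (f x) < r" if "m \<le> n" for n
      proof -
        have "dist (f x) (d (k n x)) \<le> dist (f x) (d m)"
          using Pk[of n x] that unfolding P_def by simp
        then show ?thesis using m by (simp add: dist_commute)
      qed
      then show "\<exists>m. \<forall>n\<ge>m. dist (d (k n x)) (f x) < r" by blast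
    qed
    ultimately show ?thesis
      unfolding strongly_measurable_def by (intro exI[of _ "\<lambda>n x. d (k n x)"] conjI allI ballI)
  qed
qed

text \<open>Both halves of the criterion survive pointwise limits: distances converge, and the
  closure of the union of the countable sets \<open>D n\<close> contains the limit values.\<close>

lemma strongly_measurable_LIMSEQ:
  assumes s: "\<And>n. strongly_measurable M (s n)"
    and lim: "\<And>x. x \<in> space M \<Longrightarrow> (\<lambda>n. s n x) \<longlonglongrightarrow> f x"
  shows "strongly_measurable M f"
  unfolding strongly_measurable_iff
proof (intro conjI allI)
  show "(\<lambda>x. dist (f x) c) \<in> borel_measurable M" for c
  proof (rule borel_measurable_LIMSEQ_metric)
    show "(\<lambda>x. dist (s n x) c) \<in> borel_measurable M" for n
      using s[of n] by (simp add: strongly_measurable_iff)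
    show "x \<in> space M \<Longrightarrow> (\<lambda>n. dist (s n x) c) \<longlonglongrightarrow> dist (f x) c" for x
      by (intro tendsto_intros lim)
  qed
  obtain D where D: "\<And>n. countable (D n)" "\<And>n. s n ` space M \<subseteq> closure (D n)"
    using s unfolding strongly_measurable_iff by metis
  have "f x \<in> closure (\<Union>n. D n)" if "x \<in> space M" for x
  proof (rule closed_sequentially[OF closed_closure _ lim[OF that]])
    show "s n x \<in> closure (\<Union>n. D n)" for n
      using D(2)[of n] that closure_mono[of "D n" "\<Union>n. D n"] by blast
  qed
  then show "\<exists>D. countable D \<and> f ` space M \<subseteq> closure D"
    using D(1) by (intro exI[of _ "\<Union>n. D n"]) auto
qed

text \<open>Meant for maps such as \<open>\<lambda>w. \<Lambda> w (orth_proj (W w) f)\<close>, where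
  operator and argument both vary with \<open>w\<close>. With a simple function as argument only
  countably many maps \<open>\<lambda>w. L w c\<close> occur; continuity of \<open>L w\<close> then
  carries the claim to the limit.\<close>

lemma strongly_measurable_compose_family:
  assumes X: "strongly_measurable M X"
    and L: "\<And>c. strongly_measurable M (\<lambda>w. L w c)"
    and cont: "\<And>w. w \<in> space M \<Longrightarrow> continuous_on UNIV (L w)"
  shows "strongly_measurable M (\<lambda>w. L w (X w))"
proof -
  from X obtain s where s: "\<And>n. simple_function M (s n)"
    and lim: "\<And>x. x \<in> space M \<Longrightarrow> (\<lambda>n. s n x) \<longlonglongrightarrow> X x"
    unfolding strongly_measurable_def by blast
  show ?thesis
  proof (rule strongly_measurable_LIMSEQ)
    show "(\<lambda>n. L w (s n w)) \<longlonglongrightarrow> L w (X w)" if "w \<in> space M" for w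
      using continuous_on_tendsto_compose[OF cont[OF that] lim[OF that]] by simp
    show "strongly_measurable M (\<lambda>w. L w (s n w))" for n
      unfolding strongly_measurable_iff
    proof (intro conjI allI)
      let ?I = "s n ` space M"
      have I: "countable ?I" using s by (intro countable_finite simple_functionD)
      have "s n \<in> measurable M (count_space ?I)"
        by (rule measurable_count_space_extend[OF subset_UNIV _ measurable_simple_function[OF s]]) auto
      then show "(\<lambda>w. dist (L w (s n w)) c) \<in> borel_measurable M" for c
        using L I by (rule_tac measurable_compose_countable'[where f = "\<lambda>i w. dist (L w i) c"])
          (simp_all add: strongly_measurable_iff)
      obtain D where D: "\<And>c. countable (D c)" "\<And>c. (\<lambda>w. L w c) ` space M \<subseteq> closure (D c)"
        using L unfolding strongly_measurable_iff by metis
      have "L w (s n w) \<in> closure (\<Union>c\<in>?I. D c)" if "w \<in> space M" for w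
        using D(2)[of "s n w"] that closure_mono[of "D (s n w)" "\<Union>c\<in>?I. D c"] by blast
      then show "\<exists>D. countable D \<and> (\<lambda>w. L w (s n w)) ` space M \<subseteq> closure D"
        using D(1) I by (intro exI[of _ "\<Union>c\<in>?I. D c"] conjI countable_UN) auto
    qed
  qed
qed

lemma borel_measurable_strongly_measurable:
  fixes f :: "'x \<Rightarrow> 'h::metric_space" and g :: "'h \<Rightarrow> real"
  assumes "strongly_measurable M f" "continuous_on UNIV g"
  shows "(\<lambda>x. g (f x)) \<in> borel_measurable M"
proof -
  from assms(1) obtain s where s: "\<And>n. simple_function M (s n)"
    and lim: "\<And>x. x \<in> space M \<Longrightarrow> (\<lambda>n. s n x) \<longlonglongrightarrow> f x"
    unfolding strongly_measurable_def by blast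
  show ?thesis
  proof (rule borel_measurable_LIMSEQ_metric)
    show "(\<lambda>x. g (s n x)) \<in> borel_measurable M" for n
      by (rule borel_measurable_simple_function[OF simple_function_compose1[OF s]])
    show "(\<lambda>n. g (s n x)) \<longlonglongrightarrow> g (f x)" if "x \<in> space M" for x
      using continuous_on_tendsto_compose[OF assms(2) lim[OF that]] by simp
  qed
qed

lemma strongly_measurable_orth_proj_image:
  fixes T :: "'h::{real_inner,polish_space} \<Rightarrow> 'h"
  assumes T: "bounded_linear T"
    and W: "\<And>w. w \<in> space M \<Longrightarrow> closed (W w) \<and> subspace (W w)"
    and W': "\<And>w. w \<in> space M \<Longrightarrow> closed (T ` W w)"
    and meas: "\<And>f. strongly_measurable M (\<lambda>w. orth_proj (W w) f)"
  shows "strongly_measurable M (\<lambda>w. orth_proj (T ` W w) f)"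
proof -
  interpret T: bounded_linear T by fact
  define P where "P w = orth_proj (T ` W w)" for w
  have sub: "subspace (T ` W w)" if "w \<in> space M" for w
    using W[OF that] T.linear_axioms by (intro linear_subspace_image) auto
  note cs = W' sub
  obtain D :: "'h set" where D: "countable D" "\<And>X. open X \<Longrightarrow> X \<noteq> {} \<Longrightarrow> \<exists>d\<in>D. d \<in> X"
    by (rule countable_dense_setE) blast
  have dense: "\<exists>d\<in>D. dist d x < e" if "e > 0" for x e
    using D(2)[of "ball x e"] that by (auto simp: dist_commute)
  then have "D \<noteq> {}" using zero_less_one by blast
  obtain C where C: "C > 0" "\<And>x. norm (T x) \<le> norm x * C" using T.pos_bounded by blast
  \<comment> \<open>Every \<open>T (orth_proj (W w) d)\<close> lies in the image, so no term beats
    the residual. Conversely the projection is \<open>T u\<close> with \<open>u\<close> in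
    \<open>W w\<close>, and projecting a nearby \<open>d\<close> brings it no farther from
    \<open>u\<close>.\<close>
  have residual: "norm (f - P w f) = (INF d\<in>D. norm (f - T (orth_proj (W w) d)))"
    if w: "w \<in> space M" for w f
  proof (rule antisym)
    note Ww = W[OF w, THEN conjunct1] W[OF w, THEN conjunct2]
    show "norm (f - P w f) \<le> (INF d\<in>D. norm (f - T (orth_proj (W w) d)))"
      unfolding P_def using \<open>D \<noteq> {}\<close>
      by (intro cINF_greatest norm_orth_proj_residual_le cs w imageI orth_proj_in Ww)
    obtain u where u: "u \<in> W w" "P w f = T u"
      using orth_proj_in[OF cs[OF w], of f] unfolding P_def by auto
    show "(INF d\<in>D. norm (f - T (orth_proj (W w) d))) \<le> norm (f - P w f)"
    proof (rule field_le_epsilon)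
      fix e :: real assume "e > 0"
      \<comment> \<open>The radius \<open>e / C\<close> compensates for the factor \<open>C\<close>
        by which \<open>T\<close> may stretch distances.\<close>
      then obtain d where d: "d \<in> D" "dist d u < e / C" using dense[of "e / C"] C by auto
      have "orth_proj (W w) u = u" using u by (intro orth_proj_unique Ww) auto
      then have "u - orth_proj (W w) d = orth_proj (W w) (u - d)"
        using bounded_linear.linear[OF bounded_linear_orth_proj[OF Ww]] by (simp add: linear_diff)
      then have "norm (u - orth_proj (W w) d) \<le> norm (u - d)"
        by (simp add: norm_orth_proj_le[OF Ww])
      then have "norm (u - orth_proj (W w) d) * C \<le> e"
        using d(2) C(1) by (simp add: dist_norm norm_minus_commute pos_less_divide_eq)
          (smt (verit) mult_right_mono)
      then have "norm (T u - T (orth_proj (W w) d)) \<le> e"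
        using C(2)[of "u - orth_proj (W w) d"] by (simp add: T.diff)
      then have "norm (f - T (orth_proj (W w) d)) \<le> norm (f - P w f) + e"
        using norm_triangle_ineq[of "f - T u" "T u - T (orth_proj (W w) d)"] by (simp add: u(2))
      moreover have "(INF d\<in>D. norm (f - T (orth_proj (W w) d))) \<le> norm (f - T (orth_proj (W w) d))"
        using d(1) by (intro cINF_lower bdd_belowI[of _ 0]) auto
      ultimately show "(INF d\<in>D. norm (f - T (orth_proj (W w) d))) \<le> norm (f - P w f) + e"
        by linarith
    qed
  qed
  have [measurable]: "(\<lambda>w. norm (f - P w f)) \<in> borel_measurable M" for f
  proof -
    have [measurable]: "(\<lambda>w. norm (f - T (orth_proj (W w) d))) \<in> borel_measurable M" for d
      using meas[of d]
      by (rule borel_measurable_strongly_measurable[where g = "\<lambda>x. norm (f - T x)"])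
        (intro continuous_intros linear_continuous_on T)
    have "(\<lambda>w. INF d\<in>D. norm (f - T (orth_proj (W w) d))) \<in> borel_measurable M"
      using D(1) by (intro borel_measurable_cINF_real) measurable
    then show ?thesis by (simp add: residual cong: measurable_cong)
  qed
  have norm_P: "(norm (P w f))\<^sup>2 = (norm f)\<^sup>2 - (norm (f - P w f))\<^sup>2" if "w \<in> space M" for w f
    unfolding P_def using norm_orth_proj_residual[OF cs[OF that], of f] by simp
  \<comment> \<open>Expand the squared distance; the cross term is the inner product of
    \<open>P w f\<close> and \<open>P w c\<close>, which polarization writes through norms of
    projections.\<close>
  have dist_P: "dist (P w f) c = sqrt ((norm (P w f))\<^sup>2
      - ((norm (P w (f + c)))\<^sup>2 - (norm (P w f))\<^sup>2 - (norm (P w c))\<^sup>2) + (norm c)\<^sup>2)"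
    if w: "w \<in> space M" for w f c
  proof -
    note cw = cs[OF w]
    have "P w f \<bullet> c = P w f \<bullet> P w c"
      unfolding P_def by (simp add: orth_proj_inner_right[OF cw] orth_proj_in[OF cw])
    also have "\<dots> = ((norm (P w (f + c)))\<^sup>2 - (norm (P w f))\<^sup>2 - (norm (P w c))\<^sup>2) / 2"
      unfolding P_def
      by (simp add: dot_norm linear_add[OF bounded_linear.linear[OF bounded_linear_orth_proj[OF cw]]])
    finally have "(dist (P w f) c)\<^sup>2 = (norm (P w f))\<^sup>2
      - ((norm (P w (f + c)))\<^sup>2 - (norm (P w f))\<^sup>2 - (norm (P w c))\<^sup>2) + (norm c)\<^sup>2"
      unfolding dist_norm by (simp add: dot_norm_neg)
    then show ?thesis by (metis real_sqrt_unique zero_le_dist)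
  qed
  have "(\<lambda>w. dist (P w f) c) \<in> borel_measurable M" for c
  proof (subst measurable_cong)
    fix w assume w: "w \<in> space M"
    show "dist (P w f) c = sqrt ((norm f)\<^sup>2 - (norm (f - P w f))\<^sup>2
      - ((norm (f + c))\<^sup>2 - (norm (f + c - P w (f + c)))\<^sup>2 - ((norm f)\<^sup>2 - (norm (f - P w f))\<^sup>2)
         - ((norm c)\<^sup>2 - (norm (c - P w c))\<^sup>2)) + (norm c)\<^sup>2)"
      by (simp only: dist_P[OF w] norm_P[OF w])
  qed measurable
  moreover have "closure D = UNIV"
    using dense by (auto simp: closure_approachable)
  ultimately show ?thesis
    unfolding strongly_measurable_iff P_def[symmetric] using D(1) by auto
qed

lemma orth_proj_image_selfadjoint:
  fixes T :: "'h::{real_inner,complete_space} \<Rightarrow> 'h"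
  assumes "linear T" and sym: "\<And>x y. T x \<bullet> y = x \<bullet> T y"
    and W: "closed W" "subspace W" "closed (T ` W)"
  shows "orth_proj W (T (orth_proj (T ` W) f)) = orth_proj W (T f)"
proof (rule orth_proj_unique[OF W(2) orth_proj_in[OF W(1,2)]])
  fix u assume u: "u \<in> W"
  have TW: "closed (T ` W)" "subspace (T ` W)"
    using W assms(1) by (auto intro: linear_subspace_image)
  have "T (orth_proj (T ` W) f) \<bullet> u = T f \<bullet> u"
    using u by (simp add: sym orth_proj_inner_left[OF TW])
  then show "(T (orth_proj (T ` W) f) - orth_proj W (T f)) \<bullet> u = 0"
    using u by (simp add: inner_diff_left orth_proj_inner_left[OF W(1,2)])
qed

section \<open>Scalars\<close>

context
  fixes sc :: "'f::real_normed_field \<Rightarrow> 'h \<Rightarrow> 'h::{real_inner,complete_space}"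
  assumes sc: "hilbert_scalars sc"
begin

interpretation vector_space sc
  using sc by (simp add: hilbert_scalars_def)

lemma hilbert_scalars_subspace: "module.subspace sc U \<Longrightarrow> Real_Vector_Spaces.subspace U"
proof -
  assume U: "module.subspace sc U"
  have "r *\<^sub>R x \<in> U" if "x \<in> U" for r x
    using subspace_scale[OF U that, of "of_real r"] sc by (simp add: hilbert_scalars_def)
  then show ?thesis
    using subspace_0[OF U] subspace_add[OF U] by (intro real_vector.subspaceI)
qed

text \<open>Polarization: the inner product is a combination of squared norms, each of which picks
  up the factor \<open>(norm c)\<^sup>2\<close>.\<close>

lemma hilbert_scalars_inner: "sc c x \<bullet> sc c y = (norm c)\<^sup>2 * (x \<bullet> y)"
proof -
  have "norm (sc c x) = norm c * norm x" for x using sc by (simp add: hilbert_scalars_def)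
  then show ?thesis
    by (simp add: dot_norm scale_right_distrib[symmetric] power_mult_distrib right_diff_distrib)
qed

text \<open>
  The scalar \<open>|c|\<^sup>2 c\<^sup>-\<^sup>1\<close> is the conjugate of \<open>c\<close>, for which a
  \<^class>\<open>real_normed_field\<close> has no name.
\<close>
lemma hilbert_scalars_adjoint:
  assumes "c \<noteq> 0"
  shows "sc c x \<bullet> y = (norm c)\<^sup>2 * (x \<bullet> sc (inverse c) y)"
  using hilbert_scalars_inner[of c x "sc (inverse c) y"] assms by simp

text \<open>Moving \<open>c\<close> across the inner product turns it into a multiple of
  \<open>inverse c\<close> acting on \<open>u\<close>, and \<open>U\<close> is stable under that
  scalar. The case \<open>c = 0\<close> is separate.\<close>

lemma orth_proj_scale:
  assumes "closed_subspace sc U"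
  shows "orth_proj U (sc c x) = sc c (orth_proj U x)"
proof (rule orth_proj_unique)
  have U: "closed U" "Real_Vector_Spaces.subspace U" and U': "subspace U"
    using assms by (auto simp: closed_subspace_def hilbert_scalars_subspace)
  show "Real_Vector_Spaces.subspace U" by fact
  show "sc c (orth_proj U x) \<in> U" using U' orth_proj_in[OF U] by (intro subspace_scale)
  fix u assume "u \<in> U"
  then have "sc (inverse c) u \<in> U" using U' by (intro subspace_scale)
  then show "(sc c x - sc c (orth_proj U x)) \<bullet> u = 0"
    by (cases "c = 0")
      (simp_all add: hilbert_scalars_adjoint orth_proj_residual[OF U]
        scale_right_diff_distrib[symmetric])
qed

end

section \<open>The frame operator\<close>

text \<open>Self-adjointness of the projections and the adjoint of \<open>\<Lambda> w\<close> shift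
  the outer operators onto \<open>g\<close>; idempotence lets the projection onto
  \<open>V w v\<close> act on both factors. The symmetry in \<open>f\<close> and \<open>g\<close>
  becomes visible.\<close>

lemma relay_integrand_inner:
  fixes W :: "'w \<Rightarrow> 'h::{real_inner,complete_space} set"
    and V :: "'w \<Rightarrow> 'v \<Rightarrow> 'k::{real_inner,complete_space} set"
  assumes W: "closed (W w)" "subspace (W w)" and V: "closed (V w v)" "subspace (V w v)"
    and "bounded_linear (\<Lambda> w)"
  shows "relay_integrand W V \<Lambda> \<alpha> f w v \<bullet> g = (\<alpha> w v)\<^sup>2 *
    (orth_proj (V w v) (\<Lambda> w (orth_proj (W w) f)) \<bullet> orth_proj (V w v) (\<Lambda> w (orth_proj (W w) g)))"
proof -
  let ?p = "orth_proj (V w v) (\<Lambda> w (orth_proj (W w) f))"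
  have "orth_proj (W w) (adjoint (\<Lambda> w) ?p) \<bullet> g = \<Lambda> w (orth_proj (W w) g) \<bullet> ?p"
    using adjoint_inner[OF assms(5), of "orth_proj (W w) g" ?p]
    by (simp add: orth_proj_symmetric[OF W] inner_commute)
  also have "\<dots> = ?p \<bullet> orth_proj (V w v) (\<Lambda> w (orth_proj (W w) g))"
    by (simp add: inner_commute orth_proj_inner_right[OF V] orth_proj_in[OF V])
  finally show ?thesis by (simp add: relay_integrand_def)
qed

section \<open>The polarized energy form of a frame\<close>

locale relay_frame =
  fixes scH :: "'f::real_normed_field \<Rightarrow> 'h \<Rightarrow> 'h::{real_inner,polish_space}"
    and scK :: "'f \<Rightarrow> 'k \<Rightarrow> 'k::{real_inner,complete_space}"
    and M :: "'w measure" and N :: "'w \<Rightarrow> 'v measure"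
    and K :: "'w \<Rightarrow> 'k set"
    and W :: "'w \<Rightarrow> 'h set" and V :: "'w \<Rightarrow> 'v \<Rightarrow> 'k set"
    and \<Lambda> :: "'w \<Rightarrow> 'h \<Rightarrow> 'k" and \<alpha> :: "'w \<Rightarrow> 'v \<Rightarrow> real"
    and A B :: real
  assumes scH: "hilbert_scalars scH" and scK: "hilbert_scalars scK"
    and frame: "relay_fusion_frame_bounds scH scK M N K W V \<Lambda> \<alpha> A B"
begin

definition coeff :: "'w \<Rightarrow> 'v \<Rightarrow> 'h \<Rightarrow> 'k"
  where "coeff w v f = orth_proj (V w v) (\<Lambda> w (orth_proj (W w) f))"

text \<open>The polarization of the inner energy at \<open>w\<close>. A Bochner integral is 0 when
  the integrand is not integrable, so additivity is claimed only where the inner energies are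
  finite.\<close>

definition inner_form :: "'w \<Rightarrow> 'h \<Rightarrow> 'h \<Rightarrow> real"
  where "inner_form w f g = (LINT v|N w. (\<alpha> w v)\<^sup>2 * (coeff w v f \<bullet> coeff w v g))"

definition frame_form :: "'h \<Rightarrow> 'h \<Rightarrow> real"
  where "frame_form f g = (LINT w|M. inner_form w f g)"

text \<open>Valued in \<open>ennreal\<close>, so that infinite energy at exceptional points
  \<open>w\<close> is not hidden by a default value.\<close>

definition inner_energy :: "'w \<Rightarrow> 'h \<Rightarrow> ennreal"
  where "inner_energy w f = (\<integral>\<^sup>+v. ennreal ((\<alpha> w v)\<^sup>2 * (norm (coeff w v f))\<^sup>2) \<partial>N w)"

lemma energy_eq: "relay_energy W V \<Lambda> \<alpha> f w v = (\<alpha> w v)\<^sup>2 * (norm (coeff w v f))\<^sup>2"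
  by (simp add: relay_energy_def coeff_def)

lemma
  shows A_pos: "0 < A" and AB: "A \<le> B"
    and energy_lower: "ennreal (A * (norm f)\<^sup>2) \<le> (\<integral>\<^sup>+w. inner_energy w f \<partial>M)"
    and energy_upper: "(\<integral>\<^sup>+w. inner_energy w f \<partial>M) \<le> ennreal (B * (norm f)\<^sup>2)"
    and energy_measurable[measurable]: "(\<lambda>w. inner_energy w f) \<in> borel_measurable M"
    and W_strongly_measurable: "strongly_measurable M (\<lambda>w. orth_proj (W w) f)"
    and \<Lambda>_strongly_measurable: "strongly_measurable M (\<lambda>w. \<Lambda> w f)"
  using frame unfolding relay_fusion_frame_bounds_def inner_energy_def energy_eq by auto

lemma B_pos: "0 < B"
  using A_pos AB by linarith

lemma
  assumes w: "w \<in> space M"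
  shows W_closed_subspace: "closed_subspace scH (W w)"
    and \<Lambda>_bounded_linear: "bounded_linear (\<Lambda> w)"
    and \<Lambda>_scale_linear: "Vector_Spaces.linear scH scK (\<Lambda> w)"
    and \<Lambda>_range: "range (\<Lambda> w) \<subseteq> K w"
    and \<alpha>_measurable: "\<alpha> w \<in> borel_measurable (N w)"
    and V_strongly_measurable: "u \<in> K w \<Longrightarrow> strongly_measurable (N w) (\<lambda>v. orth_proj (V w v) u)"
    and V_closed_subspace: "v \<in> space (N w) \<Longrightarrow> closed_subspace scK (V w v)"
  using frame w unfolding relay_fusion_frame_bounds_def by auto

lemma W_subspace: "w \<in> space M \<Longrightarrow> closed (W w)" "w \<in> space M \<Longrightarrow> subspace (W w)"
  using W_closed_subspace hilbert_scalars_subspace[OF scH] unfolding closed_subspace_def by auto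

lemma V_subspace:
  assumes "w \<in> space M" "v \<in> space (N w)"
  shows "closed (V w v)" "subspace (V w v)"
  using V_closed_subspace[OF assms] hilbert_scalars_subspace[OF scK]
  unfolding closed_subspace_def by auto

lemma integrand_inner:
  "w \<in> space M \<Longrightarrow> v \<in> space (N w) \<Longrightarrow>
    relay_integrand W V \<Lambda> \<alpha> f w v \<bullet> g = (\<alpha> w v)\<^sup>2 * (coeff w v f \<bullet> coeff w v g)"
  unfolding coeff_def by (intro relay_integrand_inner W_subspace V_subspace \<Lambda>_bounded_linear)

lemma inner_form_eq:
  "w \<in> space M \<Longrightarrow> (LINT v|N w. relay_integrand W V \<Lambda> \<alpha> f w v \<bullet> g) = inner_form w f g"
  unfolding inner_form_def by (intro Bochner_Integration.integral_cong refl integrand_inner)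

lemma inner_form_measurable[measurable]: "(\<lambda>w. inner_form w f g) \<in> borel_measurable M"
proof -
  have "(\<lambda>w. LINT v|N w. relay_integrand W V \<Lambda> \<alpha> f w v \<bullet> g) \<in> borel_measurable M"
    using frame unfolding relay_fusion_frame_bounds_def by auto
  then show ?thesis by (simp add: inner_form_eq cong: measurable_cong)
qed

lemma coeff_bounded_linear:
  assumes "w \<in> space M" "v \<in> space (N w)"
  shows "bounded_linear (coeff w v)"
  unfolding coeff_def
  by (intro bounded_linear_compose[OF bounded_linear_orth_proj[OF V_subspace[OF assms]]]
      bounded_linear_compose[OF \<Lambda>_bounded_linear[OF assms(1)]]
      bounded_linear_orth_proj W_subspace assms)

lemma coeff_scale:
  assumes "w \<in> space M" "v \<in> space (N w)"
  shows "coeff w v (scH c f) = scK c (coeff w v f)"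
  using \<Lambda>_scale_linear[OF assms(1)] unfolding coeff_def Vector_Spaces.linear_iff
  by (simp add: orth_proj_scale[OF scH W_closed_subspace[OF assms(1)]]
      orth_proj_scale[OF scK V_closed_subspace[OF assms]])

lemma coeff_product_measurable:
  assumes w: "w \<in> space M"
  shows "(\<lambda>v. (\<alpha> w v)\<^sup>2 * (coeff w v f \<bullet> coeff w v g)) \<in> borel_measurable (N w)"
proof -
  let ?u = "\<lambda>f. \<Lambda> w (orth_proj (W w) f)"
  have K: "?u f \<in> K w" using \<Lambda>_range[OF w] by auto
  have "(\<lambda>v. orth_proj (V w v) (?u f) \<bullet> ?u g) \<in> borel_measurable (N w)"
    using V_strongly_measurable[OF w K]
    by (rule borel_measurable_strongly_measurable[where g = "\<lambda>x. x \<bullet> ?u g"])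
      (intro continuous_intros)
  moreover have "orth_proj (V w v) (?u f) \<bullet> ?u g = coeff w v f \<bullet> coeff w v g"
    if "v \<in> space (N w)" for v
    unfolding coeff_def using V_subspace[OF w that]
    by (simp add: orth_proj_inner_right orth_proj_in)
  ultimately have "(\<lambda>v. coeff w v f \<bullet> coeff w v g) \<in> borel_measurable (N w)"
    by (simp cong: measurable_cong)
  then show ?thesis using \<alpha>_measurable[OF w] by measurable
qed

lemma coeff_energy_integrable:
  assumes w: "w \<in> space M" and fin: "inner_energy w f \<noteq> \<infinity>"
  shows "integrable (N w) (\<lambda>v. (\<alpha> w v)\<^sup>2 * (norm (coeff w v f))\<^sup>2)"
proof (rule integrableI_nonneg)
  show "(\<lambda>v. (\<alpha> w v)\<^sup>2 * (norm (coeff w v f))\<^sup>2) \<in> borel_measurable (N w)"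
    using coeff_product_measurable[OF w, of f f] by (simp add: power2_norm_eq_inner)
  show "(\<integral>\<^sup>+v. ennreal ((\<alpha> w v)\<^sup>2 * (norm (coeff w v f))\<^sup>2) \<partial>N w) < \<infinity>"
    using fin unfolding inner_energy_def by (simp add: less_top)
qed simp

text \<open>Cauchy-Schwarz and the arithmetic-geometric mean inequality give a majorant made of
  energies, which controls the mixed integrals.\<close>

lemma coeff_product_le:
  "\<bar>(\<alpha> w v)\<^sup>2 * (coeff w v f \<bullet> coeff w v g)\<bar>
    \<le> ((\<alpha> w v)\<^sup>2 * (norm (coeff w v f))\<^sup>2 + (\<alpha> w v)\<^sup>2 * (norm (coeff w v g))\<^sup>2) / 2"
proof -
  have "\<bar>coeff w v f \<bullet> coeff w v g\<bar> \<le> norm (coeff w v f) * norm (coeff w v g)"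
    by (rule Cauchy_Schwarz_ineq2)
  also have "\<dots> \<le> ((norm (coeff w v f))\<^sup>2 + (norm (coeff w v g))\<^sup>2) / 2"
    using sum_squares_bound[of "norm (coeff w v f)" "norm (coeff w v g)"] by simp
  finally have "(\<alpha> w v)\<^sup>2 * \<bar>coeff w v f \<bullet> coeff w v g\<bar>
      \<le> (\<alpha> w v)\<^sup>2 * (((norm (coeff w v f))\<^sup>2 + (norm (coeff w v g))\<^sup>2) / 2)"
    by (rule mult_left_mono) simp
  then show ?thesis by (simp add: abs_mult distrib_left)
qed

lemma coeff_product_integrable:
  assumes w: "w \<in> space M" and fin: "inner_energy w f \<noteq> \<infinity>" "inner_energy w g \<noteq> \<infinity>"
  shows "integrable (N w) (\<lambda>v. (\<alpha> w v)\<^sup>2 * (coeff w v f \<bullet> coeff w v g))"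
proof (rule Bochner_Integration.integrable_bound)
  show "integrable (N w) (\<lambda>v. ((\<alpha> w v)\<^sup>2 * (norm (coeff w v f))\<^sup>2 + (\<alpha> w v)\<^sup>2 * (norm (coeff w v g))\<^sup>2) / 2)"
    using coeff_energy_integrable[OF w] fin by simp
  show "AE v in N w. norm ((\<alpha> w v)\<^sup>2 * (coeff w v f \<bullet> coeff w v g))
      \<le> norm (((\<alpha> w v)\<^sup>2 * (norm (coeff w v f))\<^sup>2 + (\<alpha> w v)\<^sup>2 * (norm (coeff w v g))\<^sup>2) / 2)"
    using order_trans[OF coeff_product_le abs_ge_self] by simp
qed (rule coeff_product_measurable[OF w])

lemma inner_form_energy:
  assumes w: "w \<in> space M" and fin: "inner_energy w f \<noteq> \<infinity>"
  shows "ennreal (inner_form w f f) = inner_energy w f"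
  unfolding inner_form_def inner_energy_def power2_norm_eq_inner[symmetric]
  by (rule nn_integral_eq_integral[symmetric, OF coeff_energy_integrable[OF w fin]]) simp

lemma inner_form_nonneg: "0 \<le> inner_form w f f"
  unfolding inner_form_def by (intro integral_nonneg_AE) simp

lemma inner_form_le:
  assumes w: "w \<in> space M" and fin: "inner_energy w f \<noteq> \<infinity>" "inner_energy w g \<noteq> \<infinity>"
  shows "\<bar>inner_form w f g\<bar> \<le> (inner_form w f f + inner_form w g g) / 2"
proof -
  note int = coeff_product_integrable[OF w]
  have "\<bar>inner_form w f g\<bar> \<le> (LINT v|N w. \<bar>(\<alpha> w v)\<^sup>2 * (coeff w v f \<bullet> coeff w v g)\<bar>)"
    unfolding inner_form_def by (rule integral_abs_bound)
  also have "\<dots> \<le> (LINT v|N w. ((\<alpha> w v)\<^sup>2 * (coeff w v f \<bullet> coeff w v f)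
      + (\<alpha> w v)\<^sup>2 * (coeff w v g \<bullet> coeff w v g)) / 2)"
    using fin coeff_product_le[of w _ f g]
    by (intro integral_mono integrable_abs int Bochner_Integration.integrable_divide
        Bochner_Integration.integrable_add) (simp_all add: power2_norm_eq_inner)
  also have "\<dots> = (inner_form w f f + inner_form w g g) / 2"
    unfolding inner_form_def using fin by (simp add: int)
  finally show ?thesis .
qed

lemma inner_form_add:
  assumes w: "w \<in> space M"
    and fin: "inner_energy w f \<noteq> \<infinity>" "inner_energy w g \<noteq> \<infinity>" "inner_energy w h \<noteq> \<infinity>"
  shows "inner_form w (f + g) h = inner_form w f h + inner_form w g h"
proof -
  have "inner_form w (f + g) h = (LINT v|N w. (\<alpha> w v)\<^sup>2 * (coeff w v f \<bullet> coeff w v h)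
      + (\<alpha> w v)\<^sup>2 * (coeff w v g \<bullet> coeff w v h))"
    unfolding inner_form_def
    by (intro Bochner_Integration.integral_cong refl)
      (simp add: linear_add[OF bounded_linear.linear[OF coeff_bounded_linear[OF w]]]
        inner_add_left distrib_left)
  then show ?thesis
    unfolding inner_form_def using fin by (simp add: coeff_product_integrable[OF w])
qed

text \<open>A constant factor passes through the Bochner integral even where the default value 0 is
  taken, so the identity holds at every point of \<open>space M\<close>.\<close>

lemma inner_form_scaleR:
  assumes w: "w \<in> space M"
  shows "inner_form w (r *\<^sub>R f) g = r * inner_form w f g"
proof -
  have "inner_form w (r *\<^sub>R f) g = (LINT v|N w. r * ((\<alpha> w v)\<^sup>2 * (coeff w v f \<bullet> coeff w v g)))"
    unfolding inner_form_def
    by (intro Bochner_Integration.integral_cong refl)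
      (simp add: linear_scale[OF bounded_linear.linear[OF coeff_bounded_linear[OF w]]])
  then show ?thesis unfolding inner_form_def by simp
qed

lemma inner_form_scale:
  assumes w: "w \<in> space M" and c: "c \<noteq> 0"
  shows "inner_form w (scH c f) g = (norm c)\<^sup>2 * inner_form w f (scH (inverse c) g)"
proof -
  have "inner_form w (scH c f) g
      = (LINT v|N w. (norm c)\<^sup>2 * ((\<alpha> w v)\<^sup>2 * (coeff w v f \<bullet> coeff w v (scH (inverse c) g))))"
    unfolding inner_form_def
    by (intro Bochner_Integration.integral_cong refl)
      (simp add: coeff_scale[OF w] hilbert_scalars_adjoint[OF scK c])
  then show ?thesis unfolding inner_form_def by simp
qed

text \<open>The upper frame bound makes the outer integral finite, so infinite inner energy occurs
  only on a null set. The pointwise facts about \<open>inner_form\<close> thereby become usable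
  under the outer integral.\<close>

lemma AE_energy_finite: "AE w in M. inner_energy w f \<noteq> \<infinity>"
  using energy_upper[of f] by (intro nn_integral_PInf_AE) (auto simp: top_unique)

lemma nn_integral_inner_form: "(\<integral>\<^sup>+w. ennreal (inner_form w f f) \<partial>M) = (\<integral>\<^sup>+w. inner_energy w f \<partial>M)"
proof (rule nn_integral_cong_AE)
  show "AE w in M. ennreal (inner_form w f f) = inner_energy w f"
    using AE_energy_finite[of f] AE_space by eventually_elim (rule inner_form_energy)
qed

lemma inner_form_diag_integrable: "integrable M (\<lambda>w. inner_form w f f)"
proof (rule integrableI_nonneg)
  show "(\<integral>\<^sup>+w. ennreal (inner_form w f f) \<partial>M) < \<infinity>"
    unfolding nn_integral_inner_form using energy_upper[of f] by (simp add: le_less_trans)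
qed (simp_all add: inner_form_nonneg)

lemma AE_inner_form_le: "AE w in M. \<bar>inner_form w f g\<bar> \<le> (inner_form w f f + inner_form w g g) / 2"
  using AE_energy_finite[of f] AE_energy_finite[of g] AE_space
  by eventually_elim (rule inner_form_le)

lemma inner_form_integrable: "integrable M (\<lambda>w. inner_form w f g)"
proof (rule Bochner_Integration.integrable_bound)
  show "integrable M (\<lambda>w. (inner_form w f f + inner_form w g g) / 2)"
    using inner_form_diag_integrable by simp
  show "AE w in M. norm (inner_form w f g) \<le> norm ((inner_form w f f + inner_form w g g) / 2)"
    using AE_inner_form_le[of f g] by eventually_elim simp
qed measurable

lemma ennreal_frame_form: "ennreal (frame_form f f) = (\<integral>\<^sup>+w. inner_energy w f \<partial>M)"
  unfolding frame_form_def nn_integral_inner_form[symmetric]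
  by (rule nn_integral_eq_integral[symmetric, OF inner_form_diag_integrable])
    (simp add: inner_form_nonneg)

lemma frame_form_nonneg: "0 \<le> frame_form f f"
  unfolding frame_form_def by (intro integral_nonneg_AE) (simp add: inner_form_nonneg)

lemma frame_form_lower: "A * (norm f)\<^sup>2 \<le> frame_form f f"
  using energy_lower[of f] frame_form_nonneg[of f] by (simp add: ennreal_frame_form[symmetric])

lemma frame_form_upper: "frame_form f f \<le> B * (norm f)\<^sup>2"
  using energy_upper[of f] B_pos by (simp add: ennreal_frame_form[symmetric])

lemma frame_form_commute: "frame_form f g = frame_form g f"
  unfolding frame_form_def inner_form_def by (simp add: inner_commute)

lemma frame_form_add: "frame_form (f + g) h = frame_form f h + frame_form g h"
proof -
  have "frame_form (f + g) h = (LINT w|M. inner_form w f h + inner_form w g h)"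
    unfolding frame_form_def
  proof (rule integral_cong_AE)
    show "AE w in M. inner_form w (f + g) h = inner_form w f h + inner_form w g h"
      using AE_energy_finite[of f] AE_energy_finite[of g] AE_energy_finite[of h] AE_space
      by eventually_elim (rule inner_form_add)
  qed measurable
  then show ?thesis unfolding frame_form_def by (simp add: inner_form_integrable)
qed

lemma frame_form_scaleR: "frame_form (r *\<^sub>R f) g = r * frame_form f g"
  unfolding frame_form_def
  by (simp add: inner_form_scaleR cong: Bochner_Integration.integral_cong)

lemma frame_form_scale:
  "c \<noteq> 0 \<Longrightarrow> frame_form (scH c f) g = (norm c)\<^sup>2 * frame_form f (scH (inverse c) g)"
  unfolding frame_form_def
  by (simp add: inner_form_scale cong: Bochner_Integration.integral_cong)

text \<open>The form is first bounded by the mean of its two diagonal values. For unit vectors this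
  mean is at most \<open>B\<close>, and homogeneity in both arguments gives the product of
  norms.\<close>

lemma frame_form_bound: "\<bar>frame_form f g\<bar> \<le> B * norm f * norm g"
proof -
  have "\<bar>frame_form f g\<bar> \<le> (LINT w|M. (inner_form w f f + inner_form w g g) / 2)" for f g
  proof -
    have "\<bar>frame_form f g\<bar> \<le> (LINT w|M. \<bar>inner_form w f g\<bar>)"
      unfolding frame_form_def by (rule integral_abs_bound)
    also have "\<dots> \<le> (LINT w|M. (inner_form w f f + inner_form w g g) / 2)"
      using inner_form_integrable AE_inner_form_le by (intro integral_mono_AE) auto
    finally show ?thesis .
  qed
  also have "(LINT w|M. (inner_form w f f + inner_form w g g) / 2)
      = (frame_form f f + frame_form g g) / 2" for f g
    unfolding frame_form_def by (simp add: inner_form_integrable)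
  finally have half: "\<bar>frame_form f g\<bar> \<le> (frame_form f f + frame_form g g) / 2" for f g .
  show ?thesis
  proof (cases "f = 0 \<or> g = 0")
    case True
    then have "frame_form f g = 0"
      using frame_form_scaleR[of 0 0 g] frame_form_scaleR[of 0 0 f] frame_form_commute[of f g] by auto
    then show ?thesis using B_pos by simp
  next
    case False
    have "\<bar>frame_form (f /\<^sub>R norm f) (g /\<^sub>R norm g)\<bar> \<le> B"
      using half[of "f /\<^sub>R norm f" "g /\<^sub>R norm g"] False
        frame_form_upper[of "f /\<^sub>R norm f"] frame_form_upper[of "g /\<^sub>R norm g"] by simp
    moreover have "frame_form (f /\<^sub>R norm f) (g /\<^sub>R norm g) = frame_form f g / (norm f * norm g)"
      using frame_form_commute[of f "g /\<^sub>R norm g"] frame_form_commute[of f g]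
      by (simp add: frame_form_scaleR divide_inverse mult.commute)
    ultimately show ?thesis using False by (simp add: abs_mult divide_le_eq mult.assoc)
  qed
qed

section \<open>The frame operator as the representing operator of the form\<close>

abbreviation "S \<equiv> relay_frame_operator M N W V \<Lambda> \<alpha>"

text \<open>The form is bounded and linear in its second argument, so Riesz yields a representing
  vector. It is unique, and hence it is the value of the definite description.\<close>

lemma S_inner: "S f \<bullet> g = frame_form f g"
proof -
  have form: "(LINT w|M. LINT v|N w. relay_integrand W V \<Lambda> \<alpha> f w v \<bullet> g) = frame_form f g" for g
    unfolding frame_form_def by (intro Bochner_Integration.integral_cong refl inner_form_eq)
  have "bounded_linear (frame_form f)"
    by (rule bounded_linear_intro[where K = "B * norm f"])
      (use frame_form_bound[of f] frame_form_commute[of f] in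
        \<open>simp_all add: frame_form_add frame_form_scaleR mult.commute\<close>)
  then obtain h where h: "\<And>g. frame_form f g = h \<bullet> g" using riesz_representation by blast
  have "S f = h"
    unfolding relay_frame_operator_def form
  proof (rule the_equality)
    show "\<forall>g. h \<bullet> g = frame_form f g" by (simp add: h)
    show "h' = h" if "\<forall>g. h' \<bullet> g = frame_form f g" for h'
      using that by (auto simp: h inner_commute intro: vector_eq_rdot[THEN iffD1])
  qed
  then show ?thesis by (simp add: h)
qed

lemma S_eqI: "(\<And>g. S f \<bullet> g = h \<bullet> g) \<Longrightarrow> S f = h"
  using vector_eq_rdot[of "S f" h] by blast

text \<open>Test the bound of the form against \<open>g = S f\<close> and cancel one factor
  \<open>norm (S f)\<close>.\<close>

lemma S_norm_le: "norm (S f) \<le> B * norm f"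
proof (cases "S f = 0")
  case False
  have "norm (S f) * norm (S f) \<le> B * norm f * norm (S f)"
    using frame_form_bound[of f "S f"] S_inner[of f "S f"]
    by (simp add: dot_square_norm power2_eq_square)
  then show ?thesis using False by simp
qed (use B_pos in simp)

lemma S_bounded_linear: "bounded_linear S"
proof (rule bounded_linear_intro[where K = B])
  show "norm (S f) \<le> norm f * B" for f using S_norm_le[of f] by (simp add: mult.commute)
qed (auto intro!: S_eqI simp: S_inner inner_add_left frame_form_add frame_form_scaleR)

lemma S_symmetric: "S f \<bullet> g = f \<bullet> S g"
  using S_inner[of f g] S_inner[of g f] frame_form_commute[of f g] by (simp add: inner_commute)

text \<open>Tested against any \<open>g\<close>, both sides transfer \<open>c\<close> to
  \<open>g\<close> as the same conjugate scalar; this is where linearity over the full scalar field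
  enters.\<close>

lemma S_scale: "S (scH c f) = scH c (S f)"
proof (cases "c = 0")
  case True
  interpret vector_space scH using scH by (simp add: hilbert_scalars_def)
  show ?thesis using True linear_0[OF bounded_linear.linear[OF S_bounded_linear]] by simp
next
  case False
  then show ?thesis
    by (intro S_eqI) (simp add: hilbert_scalars_adjoint[OF scH] S_inner frame_form_scale)
qed

lemma S_coercive: "A * (norm f)\<^sup>2 \<le> S f \<bullet> f"
  using frame_form_lower by (simp add: S_inner)

lemma S_bij: "bij S"
  by (rule coercive_bij[OF S_bounded_linear A_pos S_coercive])

section \<open>The inverse of the frame operator\<close>

abbreviation "T \<equiv> inv S"

lemma S_T: "S (T f) = f" and T_S: "T (S f) = f"
  using S_bij by (simp_all add: surj_f_inv_f bij_is_surj inv_f_f bij_is_inj)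

lemma T_symmetric: "T f \<bullet> g = f \<bullet> T g"
  by (metis S_symmetric S_T)

text \<open>Coercivity at \<open>T f\<close> gives
  \<open>A * (norm (T f))\<^sup>2 \<le> f \<bullet> T f\<close>; Cauchy-Schwarz then cancels one
  norm.\<close>

lemma T_norm_le: "norm (T f) \<le> norm f / A"
proof (cases "T f = 0")
  case False
  have "A * norm (T f) * norm (T f) \<le> norm f * norm (T f)"
    using S_coercive[of "T f"] norm_cauchy_schwarz[of f "T f"]
    by (simp add: S_T power2_eq_square mult.assoc)
  then have "A * norm (T f) \<le> norm f" using False by simp
  then show ?thesis using A_pos by (simp add: pos_le_divide_eq mult.commute)
qed (use A_pos in simp)

lemma T_norm_ge: "norm f / B \<le> norm (T f)"
  using S_norm_le[of "T f"] B_pos by (simp add: S_T pos_divide_le_eq mult.commute)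

lemma T_bounded_linear: "bounded_linear T"
proof (rule bounded_linear_intro[where K = "1 / A"])
  have S: "linear S" by (rule bounded_linear.linear[OF S_bounded_linear])
  show "T (f + g) = T f + T g" for f g
    by (metis S_T T_S linear_add[OF S])
  show "T (r *\<^sub>R f) = r *\<^sub>R T f" for r f
    by (metis S_T T_S linear_scale[OF S])
  show "norm (T f) \<le> norm f * (1 / A)" for f using T_norm_le[of f] by simp
qed

lemma T_scale: "T (scH c f) = scH c (T f)"
  by (metis S_T T_S S_scale)

text \<open>The image under the inverse is the preimage under \<open>S\<close>, so closedness
  follows from continuity of \<open>S\<close>.\<close>

lemma T_image_closed_subspace:
  assumes "closed_subspace scH U"
  shows "closed_subspace scH (T ` U)"
proof -
  interpret vector_space scH using scH by (simp add: hilbert_scalars_def)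
  have "T ` U = S -` U" using S_bij by (simp add: bij_vimage_eq_inv_image)
  moreover have "closed (S -` U)"
    using assms S_bounded_linear
    by (intro continuous_closed_vimage) (auto simp: closed_subspace_def intro: linear_continuous_at)
  moreover have "module.subspace scH (S -` U)"
    using assms linear_0[OF bounded_linear.linear[OF S_bounded_linear]]
      linear_add[OF bounded_linear.linear[OF S_bounded_linear]]
    by (simp add: closed_subspace_def subspace_def S_scale)
  ultimately show ?thesis by (simp add: closed_subspace_def)
qed

section \<open>The dual family and its frame bounds\<close>

lemma dual_relay_fusion_frame_bounds:
  fixes W' \<Lambda>'
  defines "W' \<equiv> \<lambda>w. T ` W w" and "\<Lambda>' \<equiv> \<lambda>w. \<Lambda> w \<circ> orth_proj (W w) \<circ> T"
  shows "relay_fusion_frame_bounds scH scK M N K W' V \<Lambda>' \<alpha> (A / B\<^sup>2) (B / A\<^sup>2)"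
proof -
  have W'_closed: "closed_subspace scH (W' w)" if "w \<in> space M" for w
    unfolding W'_def by (rule T_image_closed_subspace[OF W_closed_subspace[OF that]])
  then have W': "closed (W' w)" "subspace (W' w)" if "w \<in> space M" for w
    using that by (auto simp: closed_subspace_def hilbert_scalars_subspace[OF scH])
  have \<Lambda>'_bounded: "bounded_linear (\<Lambda>' w)" if "w \<in> space M" for w
    unfolding \<Lambda>'_def comp_def
    by (intro bounded_linear_compose[OF \<Lambda>_bounded_linear[OF that]]
        bounded_linear_compose[OF bounded_linear_orth_proj[OF W_subspace[OF that]]]
        T_bounded_linear)
  have \<Lambda>'_linear: "Vector_Spaces.linear scH scK (\<Lambda>' w)" if w: "w \<in> space M" for w
    using \<Lambda>_scale_linear[OF w] linear_add[OF bounded_linear.linear[OF \<Lambda>'_bounded[OF w]]]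
    unfolding Vector_Spaces.linear_iff
    by (simp add: \<Lambda>'_def T_scale orth_proj_scale[OF scH W_closed_subspace[OF w]])
  \<comment> \<open>Because \<open>\<Lambda>' w\<close> contains the projection onto
    \<open>W w\<close>, the projection onto \<open>W' w\<close> is absorbed. Energies and integrands
    of the new family thus become those of the old one at \<open>T f\<close>.\<close>
  have \<Lambda>'_proj: "\<Lambda>' w (orth_proj (W' w) f) = \<Lambda> w (orth_proj (W w) (T f))" if w: "w \<in> space M" for w f
    using orth_proj_image_selfadjoint[OF bounded_linear.linear[OF T_bounded_linear] T_symmetric
        W_subspace[OF w] W'(1)[OF w, unfolded W'_def], of f]
    unfolding \<Lambda>'_def W'_def by simp
  have energy: "relay_energy W' V \<Lambda>' \<alpha> f w v = relay_energy W V \<Lambda> \<alpha> (T f) w v"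
    if "w \<in> space M" for f w v
    unfolding relay_energy_def by (simp add: \<Lambda>'_proj[OF that])
  have inner_energy: "(\<integral>\<^sup>+v. ennreal (relay_energy W' V \<Lambda>' \<alpha> f w v) \<partial>N w) = inner_energy w (T f)"
    if "w \<in> space M" for f w
    unfolding inner_energy_def by (simp add: energy[OF that] energy_eq)
  then have total: "(\<integral>\<^sup>+w. (\<integral>\<^sup>+v. ennreal (relay_energy W' V \<Lambda>' \<alpha> f w v) \<partial>N w) \<partial>M)
      = ennreal (frame_form (T f) (T f))" for f
    unfolding ennreal_frame_form by (intro nn_integral_cong)
  \<comment> \<open>The new weak integrand also turns into the old form, at \<open>T f\<close> and
    \<open>T g\<close>, so its measurability is inherited.\<close>
  have form: "(LINT v|N w. relay_integrand W' V \<Lambda>' \<alpha> f w v \<bullet> g) = inner_form w (T f) (T g)"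
    if w: "w \<in> space M" for f g w
    unfolding inner_form_def
  proof (intro Bochner_Integration.integral_cong refl)
    fix v assume "v \<in> space (N w)"
    from relay_integrand_inner[of W' w V v \<Lambda>', OF W'[OF w] V_subspace[OF w this] \<Lambda>'_bounded[OF w]]
    show "relay_integrand W' V \<Lambda>' \<alpha> f w v \<bullet> g = (\<alpha> w v)\<^sup>2 * (coeff w v (T f) \<bullet> coeff w v (T g))"
      by (simp add: coeff_def \<Lambda>'_proj[OF w])
  qed
  \<comment> \<open>The family \<open>\<Lambda>\<close> is applied to the strongly measurable
    argument \<open>\<lambda>w. orth_proj (W w) (T f)\<close>.\<close>
  have "strongly_measurable M (\<lambda>w. \<Lambda>' w f)" for f
    unfolding \<Lambda>'_def comp_def
    by (rule strongly_measurable_compose_family[where L = \<Lambda>])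
      (simp_all add: W_strongly_measurable \<Lambda>_strongly_measurable linear_continuous_on \<Lambda>_bounded_linear)
  moreover have "strongly_measurable M (\<lambda>w. orth_proj (W' w) f)" for f
    unfolding W'_def
    using T_bounded_linear W_subspace W'(1)[unfolded W'_def] W_strongly_measurable
    by (intro strongly_measurable_orth_proj_image) auto
  \<comment> \<open>The old bounds at \<open>T f\<close> combine with
    \<open>norm f / B \<le> norm (T f)\<close> here and with
    \<open>norm (T f) \<le> norm f / A\<close> for the upper bound; the squares account for the new
    constants.\<close>
  moreover have "A / B\<^sup>2 * (norm f)\<^sup>2 \<le> frame_form (T f) (T f)" for f
  proof -
    have "A * (norm f / B)\<^sup>2 \<le> A * (norm (T f))\<^sup>2"
      using T_norm_ge[of f] A_pos B_pos by (intro mult_left_mono power_mono) auto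
    also have "\<dots> \<le> frame_form (T f) (T f)" by (rule frame_form_lower)
    finally show ?thesis by (simp add: power_divide)
  qed
  moreover have "frame_form (T f) (T f) \<le> B / A\<^sup>2 * (norm f)\<^sup>2" for f
  proof -
    have "frame_form (T f) (T f) \<le> B * (norm (T f))\<^sup>2" by (rule frame_form_upper)
    also have "\<dots> \<le> B * (norm f / A)\<^sup>2"
      using T_norm_le[of f] B_pos by (intro mult_left_mono power_mono) auto
    finally show ?thesis by (simp add: power_divide)
  qed
  moreover have "A / B\<^sup>2 \<le> B / A\<^sup>2"
    using A_pos AB B_pos by (intro frac_le power_mono) auto
  moreover have "range (\<Lambda>' w) \<subseteq> K w" if "w \<in> space M" for w
    using \<Lambda>_range[OF that] by (auto simp: \<Lambda>'_def)
  moreover have "\<forall>w\<in>space M. \<forall>v\<in>space (N w). closed_subspace scK (V w v) \<and> V w v \<subseteq> K w \<and> 0 < \<alpha> w v"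
    using frame unfolding relay_fusion_frame_bounds_def by blast
  moreover have "(\<lambda>w. \<integral>\<^sup>+v. ennreal (relay_energy W' V \<Lambda>' \<alpha> f w v) \<partial>N w) \<in> borel_measurable M" for f
    using energy_measurable[of "T f"] by (simp add: inner_energy cong: measurable_cong)
  moreover have "(\<lambda>w. LINT v|N w. relay_integrand W' V \<Lambda>' \<alpha> f w v \<bullet> g) \<in> borel_measurable M" for f g
    using inner_form_measurable[of "T f" "T g"] by (simp add: form cong: measurable_cong)
  ultimately show ?thesis
    unfolding relay_fusion_frame_bounds_def total
    using W'_closed \<Lambda>'_linear \<Lambda>'_bounded \<alpha>_measurable V_strongly_measurable A_pos B_pos
    by (simp add: ennreal_leI)
qed

end

theorem theorem3p4:
  fixes scH :: "'f::real_normed_field \<Rightarrow> 'h \<Rightarrow> 'h::{real_inner,polish_space}"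
    and scK :: "'f \<Rightarrow> 'k \<Rightarrow> 'k::{real_inner,complete_space}"
    and M :: "'w measure" and N :: "'w \<Rightarrow> 'v measure"
    and K :: "'w \<Rightarrow> 'k set"
    and W W' :: "'w \<Rightarrow> 'h set" and V :: "'w \<Rightarrow> 'v \<Rightarrow> 'k set"
    and \<Lambda> \<Lambda>' :: "'w \<Rightarrow> 'h \<Rightarrow> 'k" and \<alpha> :: "'w \<Rightarrow> 'v \<Rightarrow> real"
    and S :: "'h \<Rightarrow> 'h"
  assumes "hilbert_scalars scH" and "hilbert_scalars scK"
    and "\<And>w. w \<in> space M \<Longrightarrow> closed_subspace scK (K w) \<and> separable_space (top_of_set (K w))"
    and "continuous_relay_fusion_frame scH scK M N K W V \<Lambda> \<alpha>"
    and "S = relay_frame_operator M N W V \<Lambda> \<alpha>"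
    and "\<And>w. W' w = inv S ` W w"
    and "\<And>w. \<Lambda>' w = \<Lambda> w \<circ> orth_proj (W w) \<circ> inv S"
  shows "continuous_relay_fusion_frame scH scK M N K W' V \<Lambda>' \<alpha>"
proof -
  obtain A B where "relay_fusion_frame_bounds scH scK M N K W V \<Lambda> \<alpha> A B"
    using assms(4) unfolding continuous_relay_fusion_frame_def by blast
  then interpret relay_frame scH scK M N K W V \<Lambda> \<alpha> A B
    using assms(1,2) by unfold_locales
  have "W' = (\<lambda>w. inv S ` W w)" "\<Lambda>' = (\<lambda>w. \<Lambda> w \<circ> orth_proj (W w) \<circ> inv S)"
    using assms(6,7) by auto
  then show ?thesis
    using dual_relay_fusion_frame_bounds unfolding assms(5) continuous_relay_fusion_frame_def by blast
qed

end
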